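(* Let $H(X,Y,E)$ be a complete bipartite $r$-uniform hypergraph with $n$ vertices in total ($n=|X|+|Y|$), where $n\ge 3$ and $3\le r\le n$. Then the domatic number of $H$ is $d(H)=n$ and the total domatic number of $H$ is $d_t(H)=\lfloor n/2\rfloor$.
   Context: A hypergraph has a finite vertex set and a set of hyperedges, each a subset of the vertex set; it is $r$-uniform if every hyperedge has exactly $r$ vertices. A complete bipartite $r$-uniform hypergraph $H(X,Y,E)$ has vertex set $X\cup Y$ with $X,Y$ disjoint and nonempty, and its hyperedges are all $r$-element subsets of $X\cup Y$ containing at least one vertex of $X$ and at least one vertex of $Y$. Two distinct vertices are adjacent if they lie in a common hyperedge; a vertex is not adjacent to itself. A dominating set is a subset $D$ of vertices such that every vertex outside $D$ is adjacent to some vertex of $D$. The domatic number $d(H)$ is the maximum number of classes in a partition of the vertex set into dominating sets. A total dominating set is a subset $T$ of vertices such that every vertex is adjacent to some vertex of $T$; the total domatic number $d_t(H)$ is the maximum number of classes in a partition of the vertex set into total dominating sets. *)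

theory Defs
  imports Main "HOL-Library.Disjoint_Sets"
begin

definition hypergraph :: "'a set \<Rightarrow> 'a set set \<Rightarrow> bool" where
  "hypergraph V E \<longleftrightarrow> finite V \<and> (\<forall>e\<in>E. e \<subseteq> V)"

definition uniform_hypergraph :: "nat \<Rightarrow> 'a set \<Rightarrow> 'a set set \<Rightarrow> bool" where
  "uniform_hypergraph r V E \<longleftrightarrow> hypergraph V E \<and> (\<forall>e\<in>E. card e = r)"

definition complete_bipartite_hypergraph ::
    "nat \<Rightarrow> 'a set \<Rightarrow> 'a set \<Rightarrow> 'a set set \<Rightarrow> bool" where
  "complete_bipartite_hypergraph r X Y E \<longleftrightarrow>
     finite X \<and> finite Y \<and> X \<inter> Y = {} \<and> X \<noteq> {} \<and> Y \<noteq> {} \<and>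
     E = {e. e \<subseteq> X \<union> Y \<and> card e = r \<and> e \<inter> X \<noteq> {} \<and> e \<inter> Y \<noteq> {}}"

lemma complete_bipartite_imp_uniform:
  "complete_bipartite_hypergraph r X Y E \<Longrightarrow> uniform_hypergraph r (X \<union> Y) E"
  by (auto simp: complete_bipartite_hypergraph_def uniform_hypergraph_def hypergraph_def)

definition adjacent :: "'a set set \<Rightarrow> 'a \<Rightarrow> 'a \<Rightarrow> bool" where
  "adjacent E u v \<longleftrightarrow> u \<noteq> v \<and> (\<exists>e\<in>E. u \<in> e \<and> v \<in> e)"

definition dominating_set :: "'a set \<Rightarrow> 'a set set \<Rightarrow> 'a set \<Rightarrow> bool" where
  "dominating_set V E D \<longleftrightarrow> D \<subseteq> V \<and> (\<forall>v\<in>V - D. \<exists>u\<in>D. adjacent E v u)"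

definition total_dominating_set :: "'a set \<Rightarrow> 'a set set \<Rightarrow> 'a set \<Rightarrow> bool" where
  "total_dominating_set V E T \<longleftrightarrow> T \<subseteq> V \<and> (\<forall>v\<in>V. \<exists>u\<in>T. adjacent E v u)"

text \<open>
  For finite \<open>V\<close> the sets of cardinalities below are finite, so \<open>Max\<close> is a genuine maximum
  whenever some admissible partition exists. The trivial partition \<open>{V}\<close> is always admissible for
  the domatic number of a nonempty \<open>V\<close>; for the total domatic number an admissible partition
  exists exactly if no vertex is isolated, and otherwise the value is unspecified.
\<close>

definition domatic_number :: "'a set \<Rightarrow> 'a set set \<Rightarrow> nat" where
  "domatic_number V E =
     Max {card P | P. partition_on V P \<and> (\<forall>D\<in>P. dominating_set V E D)}"

definition total_domatic_number :: "'a set \<Rightarrow> 'a set set \<Rightarrow> nat" where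
  "total_domatic_number V E =
     Max {card P | P. partition_on V P \<and> (\<forall>T\<in>P. total_dominating_set V E T)}"

lemma finite_partition_cards:
  assumes "finite V"
  shows "finite {card P | P. partition_on V P \<and> (\<forall>D\<in>P. Q D)}"
proof (rule finite_subset)
  show "{card P | P. partition_on V P \<and> (\<forall>D\<in>P. Q D)} \<subseteq> card ` Pow (Pow V)"
    by (auto simp: partition_on_def)
  show "finite (card ` Pow (Pow V))"
    using assms by simp
qed

end

theory Submission
  imports Defs
begin

text \<open>
  Since \<open>r \<ge> 3\<close>, any two distinct vertices, completed if necessary by a vertex of the opposite side,
  extend to a hyperedge, so any two distinct vertices are adjacent. Hence every nonempty set of
  vertices dominates, and the total dominating sets are exactly those with at least two
  elements.
\<close>

lemma complete_bipartite_adjacent: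
  assumes H: "complete_bipartite_hypergraph r X Y E"
    and r: "3 \<le> r" "r \<le> card X + card Y"
    and uv: "u \<in> X \<union> Y" "v \<in> X \<union> Y" "u \<noteq> v"
  shows "adjacent E u v"
proof -
  have fin: "finite X" "finite Y" and XY: "X \<inter> Y = {}" "X \<noteq> {}" "Y \<noteq> {}"
    and E: "E = {e. e \<subseteq> X \<union> Y \<and> card e = r \<and> e \<inter> X \<noteq> {} \<and> e \<inter> Y \<noteq> {}}"
    using H by (auto simp: complete_bipartite_hypergraph_def)
  \<comment> \<open>If \<open>u\<close> and \<open>v\<close> share a side, \<open>w\<close> comes
    from the other side; otherwise \<open>w\<close> may be \<open>u\<close> or \<open>v\<close>
    itself. Either way \<open>{u, v, w}\<close> has at most three elements, so
    \<open>r \<ge> 3\<close> leaves room for it.\<close>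
  obtain w where w: "w \<in> X \<union> Y" "{u, v, w} \<inter> X \<noteq> {}" "{u, v, w} \<inter> Y \<noteq> {}"
    using XY uv by blast
  have "card {u, v, w} \<le> r"
    using card_insert_le_m1[of 3 "{v, w}" u] r by (auto simp: card_insert_if)
  moreover have "r \<le> card (X \<union> Y)"
    using r fin XY by (simp add: card_Un_disjoint)
  ultimately obtain e where "{u, v, w} \<subseteq> e" "e \<subseteq> X \<union> Y" "card e = r"
    using exists_subset_between[of "{u, v, w}" r "X \<union> Y"] uv w(1) fin by auto
  \<comment> \<open>Meeting both sides passes from \<open>{u, v, w}\<close> to every
    superset.\<close>
  moreover from this w have "e \<in> E"
    unfolding E by blast
  ultimately show ?thesis
    using uv by (auto simp: adjacent_def)
qed

text \<open>Upper bound by counting: the classes are disjoint and cover \<open>V\<close>, so their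
  sizes add up to \<open>card V\<close>.\<close>

lemma card_partition_on_mult_le:
  assumes "finite V" "partition_on V P" "\<And>D. D \<in> P \<Longrightarrow> k \<le> card D"
  shows "card P * k \<le> card V"
proof -
  have "card P * k \<le> (\<Sum>D\<in>P. card D)"
    using sum_bounded_below[of P k card] assms(3) by simp
  also have "\<dots> = card V"
    using product_partition[OF assms(2)] assms(1,2)
    by (metis finite_subset partition_onD1 Union_upper)
  finally show ?thesis .
qed

text \<open>Greedy construction: split off a class of exactly \<open>k\<close> elements and
  partition the rest into one class fewer. The last class takes whatever is left over.\<close>

lemma ex_partition_on_card_ge:
  assumes "finite V" "0 < k" "0 < m" "m * k \<le> card V"
  shows "\<exists>P. partition_on V P \<and> card P = m \<and> (\<forall>D\<in>P. k \<le> card D)"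
  using assms(3,1,4)
proof (induction m arbitrary: V rule: nat_induct_non_zero)
  case 1
  then have "partition_on V {V}"
    using assms(2) by (auto intro!: partition_on_space)
  with 1 show ?case by (intro exI[of _ "{V}"]) auto
next
  case (Suc m)
  obtain A where A: "A \<subseteq> V" "card A = k" "finite A"
    using obtain_subset_with_card_n[of k V] Suc.prems by auto
  have "m * k \<le> card (V - A)"
    using Suc.prems A by (simp add: card_Diff_subset)
  then obtain P where P: "partition_on (V - A) P" "card P = m" "\<forall>D\<in>P. k \<le> card D"
    using Suc.IH[of "V - A"] Suc.prems by auto
  have "A \<noteq> {}"
    using A assms(2) by auto
  have "finite P"
    using P(1) Suc.prems(1) by (metis finite_Diff finite_elements)
  \<comment> \<open>A nonempty \<open>A\<close> cannot be a class of a partition of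
    \<open>V - A\<close>; hence inserting it raises the number of classes by one.\<close>
  moreover have "A \<notin> P"
    using P(1) \<open>A \<noteq> {}\<close> by (auto simp: partition_on_def)
  moreover have "partition_on V (insert A P)"
    using P(1) A \<open>A \<noteq> {}\<close>
    by (auto simp: partition_on_def disjoint_def)
  ultimately show ?case
    using P A by (intro exI[of _ "insert A P"]) auto
qed

text \<open>Both domatic numbers are instances of this maximum, with \<open>k = 1\<close> and
  \<open>k = 2\<close>. Counting bounds it and the greedy partition attains it.\<close>

lemma Max_card_partition_on_card_ge:
  assumes "finite V" "0 < k" "k \<le> card V"
  shows "Max {card P | P. partition_on V P \<and> (\<forall>D\<in>P. k \<le> card D)} = card V div k"
proof (rule Max_eqI)
  show "finite {card P | P. partition_on V P \<and> (\<forall>D\<in>P. k \<le> card D)}"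
    by (rule finite_partition_cards[OF assms(1)])
  show "m \<le> card V div k"
    if "m \<in> {card P | P. partition_on V P \<and> (\<forall>D\<in>P. k \<le> card D)}" for m
    using that card_partition_on_mult_le[OF assms(1)] assms(2)
    by (auto simp: less_eq_div_iff_mult_less_eq)
  \<comment> \<open>\<open>k \<le> card V\<close> makes the quotient positive, as the construction
    requires.\<close>
  show "card V div k \<in> {card P | P. partition_on V P \<and> (\<forall>D\<in>P. k \<le> card D)}"
    using ex_partition_on_card_ge[OF assms(1,2), of "card V div k"] assms
    by (force simp: div_greater_zero_iff)
qed

lemma dominating_set_iff_card_ge:
  assumes "finite V" "V \<noteq> {}" "D \<subseteq> V"
    and adj: "\<And>u v. u \<in> V \<Longrightarrow> v \<in> V \<Longrightarrow> u \<noteq> v \<Longrightarrow> adjacent E u v"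
  shows "dominating_set V E D \<longleftrightarrow> 1 \<le> card D"
proof -
  have "1 \<le> card D \<longleftrightarrow> D \<noteq> {}"
    using assms by (metis One_nat_def Suc_le_eq card_gt_0_iff finite_subset)
  then show ?thesis
    using assms(2,3) adj unfolding dominating_set_def by blast
qed

lemma total_dominating_set_iff_card_ge:
  assumes "finite V" "V \<noteq> {}" "T \<subseteq> V"
    and adj: "\<And>u v. u \<in> V \<Longrightarrow> v \<in> V \<Longrightarrow> u \<noteq> v \<Longrightarrow> adjacent E u v"
  shows "total_dominating_set V E T \<longleftrightarrow> 2 \<le> card T"
proof
  assume T: "total_dominating_set V E T"
  with assms(2) obtain u where u: "u \<in> T"
    unfolding total_dominating_set_def by blast
  \<comment> \<open>Total domination is applied to \<open>u\<close> itself: its neighbour in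
    \<open>T\<close> differs from \<open>u\<close>, since adjacency is irreflexive.\<close>
  with T assms(3) obtain v where "v \<in> T" "u \<noteq> v"
    unfolding total_dominating_set_def adjacent_def by blast
  with u show "2 \<le> card T"
    using card_mono[of T "{u, v}"] assms(1,3) by (auto dest: finite_subset)
next
  assume "2 \<le> card T"
  then obtain u v where "u \<in> T" "v \<in> T" "u \<noteq> v"
    by (auto simp: numeral_2_eq_2 card_le_Suc_iff)
  \<comment> \<open>Any vertex differs from at least one of \<open>u\<close> and \<open>v\<close>,
    and is adjacent to that one.\<close>
  then show "total_dominating_set V E T"
    unfolding total_dominating_set_def using assms(3) adj by (metis subsetD)
qed

theorem theorem2:
  fixes X Y :: "'a set" and E :: "'a set set" and r n :: nat
  assumes "complete_bipartite_hypergraph r X Y E"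
    and "n = card X + card Y"
    and "3 \<le> n" and "3 \<le> r" and "r \<le> n"
  shows "domatic_number (X \<union> Y) E = n \<and> total_domatic_number (X \<union> Y) E = n div 2"
proof -
  let ?V = "X \<union> Y"
  have fin: "finite ?V" and ne: "?V \<noteq> {}" and n: "card ?V = n"
    using assms(1,2) by (auto simp: complete_bipartite_hypergraph_def card_Un_disjoint)
  have adj: "adjacent E u v" if "u \<in> ?V" "v \<in> ?V" "u \<noteq> v" for u v
    using complete_bipartite_adjacent[OF assms(1,4) _ that] assms(2,5) by simp
  have sub: "D \<subseteq> ?V" if "partition_on ?V P" "D \<in> P" for D P
    using that by (auto simp: partition_on_def)
  \<comment> \<open>Classes of a partition are subsets of \<open>?V\<close>, so domination can be
    replaced class by class with a bound on size.\<close>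
  have "{card P | P. partition_on ?V P \<and> (\<forall>D\<in>P. dominating_set ?V E D)} =
      {card P | P. partition_on ?V P \<and> (\<forall>D\<in>P. 1 \<le> card D)}"
    using dominating_set_iff_card_ge[OF fin ne _ adj] sub by meson
  moreover have "{card P | P. partition_on ?V P \<and> (\<forall>T\<in>P. total_dominating_set ?V E T)} =
      {card P | P. partition_on ?V P \<and> (\<forall>T\<in>P. 2 \<le> card T)}"
    using total_dominating_set_iff_card_ge[OF fin ne _ adj] sub by meson
  ultimately show ?thesis
    unfolding domatic_number_def total_domatic_number_def
    using Max_card_partition_on_card_ge[OF fin, of 1] Max_card_partition_on_card_ge[OF fin, of 2]
      n assms(3) by simp
qed

end
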